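(* Let $p$ be a prime, let $n=p^m$ be a power of $p$, and let $\lambda$ be an integer partition such that $|\lambda|\neq n-1$ and $|\lambda|$ is not a multiple of $p$. Then $c^n_\lambda\equiv 0 \pmod p$. In particular, if $|\lambda|\neq 0,\,p-1$, then $c^p_\lambda\equiv 0\pmod p$.
   Context: For a partition $\lambda=(\lambda_1\ge\cdots\ge\lambda_\ell>0)$, $|\lambda|$ is the sum of its parts, $\lambda\vdash k$ means $|\lambda|=k$, and $\ell(\lambda)=\ell$ is its number of parts; $y_\lambda=\prod_{i=1}^{\ell}y_{\lambda_i}$, with $y_\emptyset=1$. Let $R=\mathbb{Z}[y_i;\ i\geq 0]$ be the commutative polynomial ring, and let $R\langle t\rangle$ be the unital ring generated over $\mathbb{Z}$ by $t$ and the $y_i$, subject only to $y_iy_j=y_jy_i$ for all $i,j\ge0$. Let $\Delta$ be the derivation of $R\langle t\rangle$ with $\Delta(y_i)=y_{i+1}$ for all $i\ge0$ and $\Delta(t)=0$. Define $U_0=1$ and $U_{n+1}=y_0U_nt+y_0\Delta(U_n)$ for $n\ge0$. For $n\ge 1$ the integers $c^n_\lambda$ ($0\le|\lambda|<n$) are the coefficients in $$U_n=\sum_{k=1}^n\sum_{\lambda\vdash n-k}c^n_\lambda\, y_0^{n-\ell(\lambda)}y_\lambda t^k,$$ and by convention $c^n_\lambda=0$ if $|\lambda|\geq n$. *)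

theory Defs
  imports
    "HOL-Library.Poly_Mapping"
    "HOL-Computational_Algebra.Primes"
    "HOL-Number_Theory.Cong"
begin

section \<open>The ring generated by \<open>t\<close> and commuting variables \<open>y\<^sub>i\<close>\<close>

text \<open>
  The monoid with generators \<open>T\<close>, \<open>Y i\<close> and defining relations \<open>Y i Y j = Y j Y i\<close> is the
  quotient of the free monoid (words under concatenation) by the congruence generated by
  swapping adjacent \<open>Y\<close>-letters. The ring \<open>R\<langle>t\<rangle>\<close> is its integral monoid ring. As in
  \<open>Poly_Mapping\<close>, the monoid is written additively, although it is not commutative.
\<close>

datatype gen = T | Y nat

inductive swap :: "gen list \<Rightarrow> gen list \<Rightarrow> bool" where
  swapI: "swap (u @ [Y i, Y j] @ v) (u @ [Y j, Y i] @ v)"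

abbreviation word_eq :: "gen list \<Rightarrow> gen list \<Rightarrow> bool" where
  "word_eq \<equiv> swap\<^sup>*\<^sup>*"

lemma swap_sym: "swap u v \<Longrightarrow> swap v u"
  by (auto elim!: swap.cases intro: swapI)

lemma word_eq_sym: "word_eq u v \<Longrightarrow> word_eq v u"
  by (induction rule: rtranclp_induct) (auto intro: converse_rtranclp_into_rtranclp swap_sym)

lemma swap_append:
  assumes "swap u v" shows "swap (a @ u @ b) (a @ v @ b)"
  using assms
proof cases
  case (swapI x i j y)
  show ?thesis using swap.swapI[of "a @ x" i j "y @ b"] swapI by simp
qed

lemma word_eq_context: "word_eq u v \<Longrightarrow> word_eq (a @ u @ b) (a @ v @ b)"
  by (induction rule: rtranclp_induct) (auto intro: rtranclp.rtrancl_into_rtrancl swap_append)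

lemma word_eq_append:
  assumes "word_eq u u'" "word_eq v v'" shows "word_eq (u @ v) (u' @ v')"
  using word_eq_context[OF assms(1), of "[]" v] word_eq_context[OF assms(2), of u' "[]"] by auto

quotient_type mon = "gen list" / word_eq
  by (rule equivpI) (auto intro!: reflpI sympI transpI dest: word_eq_sym)

instantiation mon :: monoid_add
begin
lift_definition zero_mon :: mon is "[]" .
lift_definition plus_mon :: "mon \<Rightarrow> mon \<Rightarrow> mon" is "(@)" by (rule word_eq_append)
instance by standard (transfer; simp)+
end

type_synonym Rt = "mon \<Rightarrow>\<^sub>0 int"

definition t :: Rt where "t = Poly_Mapping.single (abs_mon [T]) 1"

definition y :: "nat \<Rightarrow> Rt" where "y i = Poly_Mapping.single (abs_mon [Y i]) 1"

lemma abs_mon_append: "abs_mon (u @ v) = abs_mon u + abs_mon v"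
  by (simp add: plus_mon.abs_eq)

lemma abs_mon_Nil: "abs_mon [] = 0"
  by (simp add: zero_mon_def)

lemma y_commute: "y i * y j = y j * y i"
proof -
  have "word_eq [Y i, Y j] [Y j, Y i]" using swapI[of "[]" i j "[]"] by auto
  then have "abs_mon [Y i, Y j] = abs_mon [Y j, Y i]" by (simp add: mon.abs_eq_iff)
  then show ?thesis
    by (simp add: y_def mult_single flip: abs_mon_append)
qed


section \<open>The derivation \<open>\<Delta>\<close>\<close>

definition derivation :: "(Rt \<Rightarrow> Rt) \<Rightarrow> bool" where
  "derivation D \<longleftrightarrow>
     (\<forall>a b. D (a + b) = D a + D b) \<and> (\<forall>a b. D (a * b) = D a * b + a * D b)"

definition \<Delta> :: "Rt \<Rightarrow> Rt" where
  "\<Delta> = (THE D. derivation D \<and> (\<forall>i. D (y i) = y (Suc i)) \<and> D t = 0)"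

fun gen_el :: "gen \<Rightarrow> Rt" where
  "gen_el T = t"
| "gen_el (Y i) = y i"

fun gen_der :: "gen \<Rightarrow> Rt" where
  "gen_der T = 0"
| "gen_der (Y i) = y (Suc i)"

definition word_el :: "gen list \<Rightarrow> Rt" where "word_el w = prod_list (map gen_el w)"

fun word_der :: "gen list \<Rightarrow> Rt" where
  "word_der [] = 0"
| "word_der (g # w) = gen_der g * word_el w + gen_el g * word_der w"

lemma word_el_append: "word_el (u @ v) = word_el u * word_el v"
  by (simp add: word_el_def)

lemma word_el_simps [simp]: "word_el [] = 1" "word_el (g # w) = gen_el g * word_el w"
  by (simp_all add: word_el_def)

lemma single_abs_mon: "Poly_Mapping.single (abs_mon w) 1 = word_el w"
proof (induction w)
  case Nil
  then show ?case by (simp add: abs_mon_Nil)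
next
  case (Cons g w)
  have "gen_el g = Poly_Mapping.single (abs_mon [g]) 1"
    by (cases g) (simp_all add: t_def y_def)
  moreover have "abs_mon (g # w) = abs_mon [g] + abs_mon w"
    using abs_mon_append[of "[g]" w] by simp
  ultimately show ?case using Cons by (simp add: mult_single flip: Cons.IH)
qed

lemma word_der_append: "word_der (u @ v) = word_der u * word_el v + word_el u * word_der v"
  by (induction u) (simp_all add: word_el_append algebra_simps)

lemma word_der_swap:
  assumes "swap u v" shows "word_der u = word_der v"
  using assms
proof cases
  case (swapI a i j b)
  have 1: "word_el [Y i, Y j] = word_el [Y j, Y i]" by (simp add: y_commute)
  have 2: "word_der [Y i, Y j] = word_der [Y j, Y i]"
    by (simp add: y_commute add.commute)
  show ?thesis unfolding swapI word_der_append word_el_append 1 2 ..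
qed

lemma word_der_eq: "word_eq u v \<Longrightarrow> word_der u = word_der v"
  by (induction rule: rtranclp_induct) (auto dest: word_der_swap)

lift_definition mon_der :: "mon \<Rightarrow> Rt" is word_der by (rule word_der_eq)

definition der :: "Rt \<Rightarrow> Rt" where "der = frag_extend mon_der"

lemma der_word: "der (word_el w) = word_der w"
  by (simp add: der_def mon_der.abs_eq frag_extend_of flip: single_abs_mon)

lemma der_add: "der (a + b) = der a + der b"
  by (simp add: der_def frag_extend_add)

lemma der_diff: "der (a - b) = der a - der b"
  by (simp add: der_def frag_extend_diff)

lemma der_0: "der 0 = 0"
  by (simp add: der_def)

lemma Rt_induct [case_names zero word diff]:
  assumes "P 0" "\<And>w. P (word_el w)" "\<And>a b. P a \<Longrightarrow> P b \<Longrightarrow> P (a - b)"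
  shows "P (a :: Rt)"
proof (rule frag_induction[of _ UNIV])
  fix m :: mon
  obtain w where "m = abs_mon w" by (metis Quotient_mon Quotient_abs_rep)
  then show "P (frag_of m)" using assms(2)[of w] by (simp add: single_abs_mon)
qed (use assms in auto)

lemma der_mult: "der (a * b) = der a * b + a * der b"
proof (induction a rule: Rt_induct)
  case (word u)
  show ?case
  proof (induction b rule: Rt_induct)
    case (word v)
    show ?case by (simp add: der_word word_der_append flip: word_el_append)
  qed (simp_all add: der_0 der_diff algebra_simps)
qed (simp_all add: der_0 der_diff algebra_simps)

lemma derivation_der: "derivation der" "der (y i) = y (Suc i)" "der t = 0"
  using der_word[of "[Y i]"] der_word[of "[T]"]
  by (simp_all add: derivation_def der_add der_mult)

lemma derivation_unique:
  assumes "derivation D" "\<forall>i. D (y i) = y (Suc i)" "D t = 0"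
  shows "D = der"
proof
  have add: "D (a + b) = D a + D b" and mult: "D (a * b) = D a * b + a * D b" for a b
    using assms(1) by (auto simp: derivation_def)
  have D0: "D 0 = 0" using add[of 0 0] by simp
  have D1: "D 1 = 0" using mult[of 1 1] by simp
  have diff: "D (a - b) = D a - D b" for a b using add[of "a - b" b] by simp
  have gen: "D (gen_el g) = gen_der g" for g using assms by (cases g) auto
  have word: "D (word_el w) = word_der w" for w
    by (induction w) (simp_all add: D1 mult gen)
  show "D a = der a" for a
    by (induction a rule: Rt_induct) (simp_all add: D0 der_0 word der_word diff der_diff)
qed

lemma \<Delta>_eq_der: "\<Delta> = der"
  unfolding \<Delta>_def using derivation_der derivation_unique by (intro the_equality) blast+

theorem \<Delta>_derivation: "derivation \<Delta>" and \<Delta>_y: "\<Delta> (y i) = y (Suc i)" and \<Delta>_t: "\<Delta> t = 0"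
  using derivation_der by (simp_all add: \<Delta>_eq_der)


section \<open>The elements \<open>U\<^sub>n\<close> and their coefficients\<close>

primrec U :: "nat \<Rightarrow> Rt" where
  "U 0 = 1"
| "U (Suc n) = y 0 * U n * t + y 0 * \<Delta> (U n)"

definition is_partition :: "nat list \<Rightarrow> bool" where
  "is_partition lam \<longleftrightarrow> sorted_wrt (\<ge>) lam \<and> (\<forall>i \<in> set lam. i > 0)"

definition partitions :: "nat \<Rightarrow> nat list set" where
  "partitions k = {lam. is_partition lam \<and> sum_list lam = k}"

definition y_part :: "nat list \<Rightarrow> Rt" where
  "y_part lam = prod_list (map y lam)"

text \<open>
  The word of the monomial \<open>y\<^sub>0\<^bsup>n - \<ell>(\<lambda>)\<^esup> y\<^sub>\<lambda> t\<^bsup>n - |\<lambda>|\<^esup>\<close>, see \<open>single_U_mon\<close>. It is used only for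
  \<open>\<ell>(\<lambda>) \<le> |\<lambda>| < n\<close>, where the subtractions are not truncated. By \<open>U_expansion\<close>, the
  coefficients at these monomials are the ones in the defining expansion of \<open>U\<^sub>n\<close>.
\<close>

definition U_mon :: "nat \<Rightarrow> nat list \<Rightarrow> mon" where
  "U_mon n lam = abs_mon (replicate (n - length lam) (Y 0) @ map Y lam @ replicate (n - sum_list lam) T)"

definition c :: "nat \<Rightarrow> nat list \<Rightarrow> int" where
  "c n lam = (if sum_list lam < n then Poly_Mapping.lookup (U n) (U_mon n lam) else 0)"

lemma word_el_map_Y: "word_el (map Y xs) = y_part xs"
  by (induction xs) (simp_all add: y_part_def)

lemma word_el_replicate: "word_el (replicate k g) = gen_el g ^ k"
  by (induction k) simp_all

lemma single_U_mon:
  "Poly_Mapping.single (U_mon n lam) 1 = y 0 ^ (n - length lam) * y_part lam * t ^ (n - sum_list lam)"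
  by (simp add: U_mon_def single_abs_mon word_el_append word_el_replicate word_el_map_Y mult.assoc)

inductive U_span :: "nat \<Rightarrow> Rt \<Rightarrow> bool" for n where
  zero: "U_span n 0"
| mono: "length xs = n \<Longrightarrow> sum_list xs + k = n \<Longrightarrow> (n > 0 \<Longrightarrow> k > 0) \<Longrightarrow> U_span n (y_part xs * t ^ k)"
| diff: "U_span n a \<Longrightarrow> U_span n b \<Longrightarrow> U_span n (a - b)"

lemma U_span_add: "U_span n a \<Longrightarrow> U_span n b \<Longrightarrow> U_span n (a + b)"
  using U_span.diff[of n a "0 - b"] U_span.diff[OF U_span.zero, of n b] by simp

lemma y_part_simps [simp]: "y_part [] = 1" "y_part (x # xs) = y x * y_part xs"
  by (simp_all add: y_part_def)

lemma y_part_append [simp]: "y_part (xs @ ys) = y_part xs * y_part ys"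
  by (simp add: y_part_def)

lemma der_t_power: "der (t ^ k) = 0"
proof -
  have "word_der (replicate k T) = 0" by (induction k) simp_all
  then show ?thesis using der_word[of "replicate k T"] by (simp add: word_el_replicate)
qed

lemma der_1: "der 1 = 0"
  using der_t_power[of 0] by simp

lemma U_span_der_aux:
  assumes "length as + length xs + 1 = n" "sum_list as + sum_list xs + 1 + k = n" "k > 0"
  shows "U_span n (y_part (0 # as) * der (y_part xs) * t ^ k)"
  using assms
proof (induction xs arbitrary: as)
  case Nil
  then show ?case by (simp add: der_1 U_span.zero)
next
  case (Cons x xs)
  have "y_part (0 # as) * der (y_part (x # xs)) * t ^ k =
      y_part (0 # as @ Suc x # xs) * t ^ k + y_part (0 # as @ [x]) * der (y_part xs) * t ^ k"
    by (simp add: der_mult derivation_der algebra_simps)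
  moreover have "U_span n (y_part (0 # as @ Suc x # xs) * t ^ k)"
    using Cons.prems by (intro U_span.mono) auto
  moreover have "U_span n (y_part (0 # as @ [x]) * der (y_part xs) * t ^ k)"
    using Cons.prems by (intro Cons.IH) auto
  ultimately show ?case by (metis U_span_add)
qed

lemma U_span_step:
  assumes "U_span n a" shows "U_span (Suc n) (y 0 * a * t + y 0 * der a)"
  using assms
proof induction
  case zero
  then show ?case by (simp add: der_0 U_span.zero)
next
  case (mono xs k)
  have "y 0 * (y_part xs * t ^ k) * t = y_part (0 # xs) * t ^ Suc k"
    by (simp add: mult.assoc power_commutes)
  moreover have "U_span (Suc n) (y_part (0 # xs) * t ^ Suc k)"
    using mono by (intro U_span.mono) auto
  moreover have "U_span (Suc n) (y 0 * der (y_part xs * t ^ k))"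
  proof (cases "n = 0")
    case True
    then show ?thesis using mono by (simp add: der_1 U_span.zero)
  next
    case False
    then have "U_span (Suc n) (y_part (0 # []) * der (y_part xs) * t ^ k)"
      using mono by (intro U_span_der_aux) auto
    then show ?thesis by (simp add: der_mult der_t_power mult.assoc)
  qed
  ultimately show ?case by (metis U_span_add)
next
  case (diff a b)
  have "y 0 * (a - b) * t + y 0 * der (a - b) =
      (y 0 * a * t + y 0 * der a) - (y 0 * b * t + y 0 * der b)"
    by (simp add: der_diff algebra_simps)
  then show ?case using diff U_span.diff by metis
qed

lemma U_span_U: "U_span n (U n)"
proof (induction n)
  case 0
  show ?case using U_span.mono[of "[]" 0 0] by simp
next
  case (Suc n)
  then show ?case using U_span_step[of n "U n"] by (simp add: \<Delta>_eq_der)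
qed

lemma y_part_mset:
  assumes "mset xs = mset ys" shows "y_part xs = y_part ys"
  using assms
proof (induction xs arbitrary: ys)
  case (Cons x xs)
  then obtain as bs where ys: "ys = as @ x # bs" by (metis list.set_intros(1) set_mset_mset split_list)
  have comm: "y x * y_part as = y_part as * y x" for as
    by (induction as) (simp_all, metis mult.assoc y_commute)
  have "y_part xs = y_part (as @ bs)" using Cons ys by (intro Cons.IH) auto
  then have "y x * y_part xs = (y x * y_part as) * y_part bs" by (simp add: mult.assoc)
  also have "\<dots> = y_part ys" by (simp only: comm) (simp add: ys mult.assoc)
  finally show ?case by simp
qed simp

lemma length_le_sum_list: "is_partition lam \<Longrightarrow> length lam \<le> sum_list lam"
proof (induction lam)
  case (Cons a lam)
  then have "is_partition lam" "a > 0" by (auto simp: is_partition_def)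
  then show ?case using Cons by auto
qed simp

lemma U_span_keys:
  assumes "U_span n a" "n > 0"
  shows "Poly_Mapping.keys a \<subseteq> U_mon n ` {lam. is_partition lam \<and> sum_list lam < n}"
  using assms
proof induction
  case (mono xs k)
  define lam where "lam = rev (sort (filter (\<lambda>x. x > 0) xs))"
  have part: "is_partition lam"
    by (auto simp: lam_def is_partition_def sorted_wrt_rev)
  have ms: "mset lam = filter_mset (\<lambda>x. x > 0) (mset xs)" by (simp add: lam_def)
  define z where "z = count (mset xs) 0"
  have ms': "mset xs = mset (replicate z 0 @ lam)"
    by (rule multiset_eqI) (simp add: z_def ms)
  have len: "z = n - length lam"
    using arg_cong[OF ms', of size] mono by simp
  have sl: "sum_list xs = sum_list lam"
    using arg_cong[OF ms', of sum_mset] by (simp add: sum_mset_sum_list sum_list_replicate)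
  have k: "k = n - sum_list lam" "sum_list lam < n" using mono sl by auto
  have "y_part xs * t ^ k = y_part (replicate z 0) * y_part lam * t ^ k"
    using y_part_mset[OF ms'] by simp
  also have "y_part (replicate z 0) = y 0 ^ z"
    by (induction z) simp_all
  finally have "y_part xs * t ^ k = Poly_Mapping.single (U_mon n lam) 1"
    by (simp add: single_U_mon len k(1))
  then show ?case using part k(2) by auto
next
  case (diff a b)
  then show ?case using keys_diff[of a b] by blast
qed simp

fun y_index :: "gen \<Rightarrow> nat multiset" where
  "y_index T = {#}"
| "y_index (Y i) = {#i#}"

lemma word_eq_y_index: "word_eq u v \<Longrightarrow> (\<Sum>g\<leftarrow>u. y_index g) = (\<Sum>g\<leftarrow>v. y_index g)"
  by (induction rule: rtranclp_induct) (auto elim!: swap.cases simp: add_ac)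

lemma inj_U_mon: "inj_on (U_mon n) {lam. is_partition lam}"
proof (rule inj_onI)
  fix lam mu assume *: "lam \<in> {lam. is_partition lam}" "mu \<in> {lam. is_partition lam}" "U_mon n lam = U_mon n mu"
  have idx: "(\<Sum>g\<leftarrow>replicate a (Y 0) @ map Y lam @ replicate b T. y_index g) =
      replicate_mset a 0 + mset lam" for a b lam
  proof -
    have "(\<Sum>g\<leftarrow>replicate a (Y 0). y_index g) = replicate_mset a 0" by (induction a) simp_all
    moreover have "(\<Sum>g\<leftarrow>map Y lam. y_index g) = mset lam" by (induction lam) simp_all
    moreover have "(\<Sum>g\<leftarrow>replicate b T. y_index g) = {#}" by (induction b) simp_all
    ultimately show ?thesis by simp
  qed
  have eq: "replicate_mset (n - length lam) 0 + mset lam = replicate_mset (n - length mu) 0 + mset mu"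
  proof -
    define w where "w = (\<lambda>nu. replicate (n - length nu) (Y 0) @ map Y nu @ replicate (n - sum_list nu) T)"
    have "abs_mon (w lam) = abs_mon (w mu)" using *(3) by (simp only: U_mon_def w_def)
    then have "word_eq (w lam) (w mu)" by (simp only: mon.abs_eq_iff)
    then have "(\<Sum>g\<leftarrow>w lam. y_index g) = (\<Sum>g\<leftarrow>w mu. y_index g)" by (rule word_eq_y_index)
    then show ?thesis by (simp only: w_def idx)
  qed
  have pos: "filter_mset (\<lambda>x. x > 0) (replicate_mset a 0 + mset nu) = mset nu"
    if "is_partition nu" for a and nu :: "nat list"
  proof -
    have "filter_mset (\<lambda>x. x > 0) (replicate_mset a (0::nat)) = {#}"
      by (rule multiset_eqI) simp
    moreover have "filter_mset (\<lambda>x. x > 0) (mset nu) = mset nu"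
      using that
      by (intro multiset_eqI) (auto simp: is_partition_def not_less count_eq_zero_iff)
    ultimately show ?thesis by (simp only: filter_union_mset add_0_left)
  qed
  have "mset lam = mset mu"
    using arg_cong[OF eq, of "filter_mset (\<lambda>x. x > 0)"] *(1,2) by (simp only: pos mem_Collect_eq)
  moreover have "sorted (rev lam)" "sorted (rev mu)"
    using * by (auto simp: is_partition_def sorted_wrt_rev)
  ultimately have "rev lam = rev mu"
    by (metis mset_rev properties_for_sort)
  then show "lam = mu" by simp
qed

lemma finite_partitions: "finite {lam. is_partition lam \<and> sum_list lam < n}"
proof (rule finite_subset)
  show "{lam. is_partition lam \<and> sum_list lam < n} \<subseteq> {xs. set xs \<subseteq> {..n} \<and> length xs \<le> n}"
  proof safe
    fix lam :: "nat list" and x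
    assume *: "is_partition lam" "sum_list lam < n"
    show "x \<le> n" if "x \<in> set lam"
      using member_le_sum_list[OF that] * by simp
    show "length lam \<le> n"
      using length_le_sum_list[OF *(1)] * by simp
  qed
qed (rule finite_lists_length_le, simp)

theorem U_expansion:
  assumes "n \<ge> 1"
  shows "U n = (\<Sum>k=1..n. \<Sum>lam\<in>partitions (n - k).
                  of_int (c n lam) * (y 0 ^ (n - length lam) * y_part lam * t ^ k))"
proof -
  let ?P = "{lam. is_partition lam \<and> sum_list lam < n}"
  let ?f = "\<lambda>lam. of_int (c n lam) * (y 0 ^ (n - length lam) * y_part lam * t ^ (n - sum_list lam))"
  have inj: "inj_on (U_mon n) ?P" using inj_U_mon by (rule inj_on_subset) auto
  have keys: "Poly_Mapping.keys (U n) \<subseteq> U_mon n ` ?P"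
    using U_span_keys[OF U_span_U] assms by simp
  have f: "?f lam = Poly_Mapping.single (U_mon n lam) (Poly_Mapping.lookup (U n) (U_mon n lam))"
    if "lam \<in> ?P" for lam
    using that by (simp add: c_def mult_single flip: single_U_mon single_of_int)
  have "U n = (\<Sum>m\<in>Poly_Mapping.keys (U n). Poly_Mapping.single m (Poly_Mapping.lookup (U n) m))"
    by (intro poly_mapping_eqI)
      (auto simp: lookup_sum lookup_single when_def in_keys_iff intro: sum.neutral)
  also have "\<dots> = (\<Sum>m\<in>U_mon n ` ?P. Poly_Mapping.single m (Poly_Mapping.lookup (U n) m))"
    using keys finite_partitions by (intro sum.mono_neutral_left) (auto simp: in_keys_iff)
  also have "\<dots> = (\<Sum>lam\<in>?P. ?f lam)"
    using f inj by (simp add: sum.reindex)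
  also have "?P = (\<Union>k\<in>{1..n}. partitions (n - k))"
  proof -
    have "lam \<in> (\<Union>k\<in>{1..n}. partitions (n - k))" if "lam \<in> ?P" for lam
      using that by (intro UN_I[of "n - sum_list lam"]) (auto simp: partitions_def)
    moreover have "lam \<in> ?P" if "lam \<in> partitions (n - k)" "k \<in> {1..n}" for lam k
      using that by (auto simp: partitions_def)
    ultimately show ?thesis by blast
  qed
  also have "(\<Sum>lam\<in>(\<Union>k\<in>{1..n}. partitions (n - k)). ?f lam) =
      (\<Sum>k=1..n. \<Sum>lam\<in>partitions (n - k). ?f lam)"
  proof (rule sum.UNION_disjoint)
    show "\<forall>k\<in>{1..n}. finite (partitions (n - k))"
      using finite_partitions[of n] by (auto simp: partitions_def elim!: rev_finite_subset)
  qed (auto simp: partitions_def)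
  also have "\<dots> = (\<Sum>k=1..n. \<Sum>lam\<in>partitions (n - k).
                  of_int (c n lam) * (y 0 ^ (n - length lam) * y_part lam * t ^ k))"
    by (intro sum.cong) (auto simp: partitions_def)
  finally show ?thesis .
qed

end

theory Submission
  imports Defs
begin

text \<open>
  If \<open>y\<^sub>i\<close> is read as the \<open>i\<close>-th derivative of a function \<open>y\<^sub>0\<close> of \<open>x\<close>, and \<open>t\<close> as \<open>d/dx\<close>, then \<open>U n\<close>
  is the normally ordered form of the \<open>n\<close>-th power of the vector field \<open>y\<^sub>0 d/dx\<close>. In characteristic
  \<open>p\<close>, the \<open>p^m\<close>-th power of a derivation is again a derivation, and a differential operator that is
  a derivation cannot contain \<open>(d/dx)^k\<close> with \<open>k\<close> prime to \<open>p\<close>, except for \<open>k = 1\<close>.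

  A single identity over the integers makes this argument explicit. Let \<open>u j\<close> be the coefficient
  of \<open>t\<close> in \<open>U j\<close>. Expanding \<open>(y\<^sub>0 d/dx)^n\<close> of a product of two functions by the Leibniz rule shows
  that the \<open>U n\<close>, as polynomials in \<open>t\<close>, form a sequence of binomial type. The part of this that is
  linear in one of the two arguments, multiplied by \<open>t\<close>, is
  \<open>euler (U n) = (\<Sum>j\<le>n. (n choose j) * u j * U (n - j)) * t\<close>,
  where \<open>euler\<close> multiplies every monomial by its degree in \<open>t\<close>. Lemma \<open>euler_U\<close> proves this
  directly, by induction on \<open>n\<close>.

  For \<open>n = p^m\<close> all binomial coefficients with \<open>0 < j < n\<close> vanish modulo \<open>p\<close>, and what remains is
  \<open>u n * t\<close>, which has degree one in \<open>t\<close>. Comparing coefficients at a monomial of degree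
  \<open>k = n - |\<lambda>| \<noteq> 1\<close> gives \<open>k c^n_\<lambda> \<equiv> 0\<close>, and \<open>k\<close> is invertible modulo \<open>p\<close>, since \<open>p\<close> divides \<open>n\<close> but
  not \<open>|\<lambda>|\<close>.
\<close>

section \<open>The Euler derivation in \<open>t\<close>\<close>

fun t_count :: "gen list \<Rightarrow> nat" where
  "t_count [] = 0"
| "t_count (T # w) = Suc (t_count w)"
| "t_count (Y i # w) = t_count w"

lemma t_count_append [simp]: "t_count (u @ v) = t_count u + t_count v"
  by (induction u rule: t_count.induct) simp_all

lemma t_count_word_eq: "word_eq u v \<Longrightarrow> t_count u = t_count v"
  by (induction rule: rtranclp_induct) (auto elim!: swap.cases)

lift_definition t_degree :: "mon \<Rightarrow> nat" is t_count by (rule t_count_word_eq)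

lemma t_degree_U_mon: "t_degree (U_mon n lam) = n - sum_list lam"
proof -
  have "t_count (replicate k (Y 0)) = 0" "t_count (map Y lam) = 0" "t_count (replicate k T) = k" for k
    by (induction k) (simp_all, induction lam, simp_all)
  then show ?thesis by (simp add: U_mon_def t_degree.abs_eq)
qed

definition euler :: "Rt \<Rightarrow> Rt" where
  "euler = frag_extend (\<lambda>m. of_nat (t_degree m) * frag_of m)"

lemma euler_add: "euler (a + b) = euler a + euler b"
  by (simp add: euler_def frag_extend_add)

lemma euler_diff: "euler (a - b) = euler a - euler b"
  by (simp add: euler_def frag_extend_diff)

lemma euler_0 [simp]: "euler 0 = 0"
  by (simp add: euler_def)

lemma euler_word: "euler (word_el w) = of_nat (t_count w) * word_el w"
  by (simp add: euler_def t_degree.abs_eq flip: single_abs_mon)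

lemma euler_gens [simp]: "euler 1 = 0" "euler (y i) = 0" "euler t = t"
  using euler_word[of "[]"] euler_word[of "[Y i]"] euler_word[of "[T]"] by simp_all

lemma lookup_of_nat_mult:
  fixes a :: Rt
  shows "Poly_Mapping.lookup (of_nat k * a) m = int k * Poly_Mapping.lookup a m"
  by (induction k) (simp_all add: lookup_add algebra_simps)

lemma lookup_euler: "Poly_Mapping.lookup (euler a) m = int (t_degree m) * Poly_Mapping.lookup a m"
proof (induction a rule: Rt_induct)
  case (word w)
  show ?case
    by (simp add: euler_word lookup_of_nat_mult)
      (auto simp: lookup_single when_def t_degree.abs_eq simp flip: single_abs_mon)
qed (simp_all add: euler_diff lookup_minus algebra_simps)

lemma euler_mult: "euler (a * b) = euler a * b + a * euler b"
proof (induction a rule: Rt_induct)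
  case (word u)
  show ?case
  proof (induction b rule: Rt_induct)
    case (word v)
    have "word_el u * (of_nat k * word_el v) = of_nat k * (word_el u * word_el v)" for k
      by (metis mult.assoc mult_of_nat_commute)
    then show ?case
      by (simp add: euler_word algebra_simps flip: word_el_append)
  qed (simp_all add: euler_diff algebra_simps)
qed (simp_all add: euler_diff algebra_simps)

lemma \<Delta>_add: "\<Delta> (a + b) = \<Delta> a + \<Delta> b"
  and \<Delta>_mult: "\<Delta> (a * b) = \<Delta> a * b + a * \<Delta> b"
  using \<Delta>_derivation by (simp_all add: derivation_def)

lemma \<Delta>_0 [simp]: "\<Delta> 0 = 0"
  by (simp add: \<Delta>_eq_der der_0)

lemma \<Delta>_of_nat_mult: "\<Delta> (of_nat k * a) = of_nat k * \<Delta> a"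
  by (induction k) (simp_all add: \<Delta>_add algebra_simps)

lemma \<Delta>_sum: "\<Delta> (\<Sum>i\<in>A. f i) = (\<Sum>i\<in>A. \<Delta> (f i))"
  by (induction A rule: infinite_finite_induct) (simp_all add: \<Delta>_add)

text \<open>\<open>\<Delta>\<close> preserves the degree in \<open>t\<close>, since it replaces letters \<open>Y i\<close> by letters \<open>Y (i + 1)\<close>.\<close>

lemma euler_\<Delta>: "euler (\<Delta> a) = \<Delta> (euler a)"
proof (induction a rule: Rt_induct)
  case (word w)
  have "euler (word_der w) = of_nat (t_count w) * word_der w"
  proof (induction w)
    case (Cons g w)
    have comm: "b * (of_nat k * a) = of_nat k * (b * a)" for k and a b :: Rt
      by (metis mult.assoc mult_of_nat_commute)
    show ?case
      by (cases g) (simp_all add: euler_add euler_mult euler_word Cons.IH comm algebra_simps)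
  qed simp
  then show ?case
    by (simp add: euler_word \<Delta>_of_nat_mult) (simp add: \<Delta>_eq_der der_word)
qed (simp_all add: \<Delta>_eq_der der_0 der_diff euler_diff)

section \<open>The linear coefficients and the binomial identity\<close>

text \<open>
  The coefficient of \<open>t\<close> in \<open>U n\<close>. Equivalently, \<open>u n\<close> is \<open>(y\<^sub>0 d/dx)^n\<close> applied to the function
  \<open>x\<close>, except that the value \<open>x\<close> at \<open>n = 0\<close> is replaced by \<open>0\<close>.
\<close>

fun u :: "nat \<Rightarrow> Rt" where
  "u 0 = 0"
| "u (Suc 0) = y 0"
| "u (Suc (Suc n)) = y 0 * \<Delta> (u (Suc n))"

lemma u_Suc: "u (Suc n) = y 0 * \<Delta> (u n) + (if n = 0 then y 0 else 0)"
  by (cases n) simp_all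

lemma euler_u [simp]: "euler (u n) = 0"
  by (induction n rule: u.induct) (simp_all add: euler_mult euler_\<Delta>)

text \<open>
  Applying \<open>\<Delta>\<close> to \<open>y\<^sub>i a = a y\<^sub>i\<close>, the terms \<open>y\<^bsub>i+1\<^esub> a = a y\<^bsub>i+1\<^esub>\<close> cancel. So the centralizer of all
  \<open>y\<^sub>i\<close> is closed under \<open>\<Delta>\<close>.
\<close>

lemma \<Delta>_commutes_y:
  assumes "\<And>i. y i * a = a * y i"
  shows "y i * \<Delta> a = \<Delta> a * y i"
proof -
  have "\<Delta> (y i * a) = \<Delta> (a * y i)" using assms by simp
  then show ?thesis using assms[of "Suc i"] by (simp add: \<Delta>_mult \<Delta>_y)
qed

lemma u_commutes_y: "y i * u n = u n * y i"
proof (induction n arbitrary: i rule: u.induct)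
  case (3 n)
  then have "y i * \<Delta> (u (Suc n)) = \<Delta> (u (Suc n)) * y i" by (intro \<Delta>_commutes_y)
  then show ?case by (simp, metis mult.assoc y_commute)
qed (simp_all add: y_commute)

text \<open>
  The operator \<open>a \<mapsto> y\<^sub>0 a t + y\<^sub>0 \<Delta>(a)\<close> that takes \<open>U n\<close> to \<open>U (n + 1)\<close> is linear, and on a product
  \<open>u j * U k\<close> it acts by the Leibniz rule, as the operator itself on \<open>U k\<close> and as \<open>y\<^sub>0 \<Delta>\<close> on \<open>u j\<close>.
\<close>

lemma step_product:
  "y 0 * (u j * U k) * t + y 0 * \<Delta> (u j * U k) = u j * U (Suc k) + y 0 * \<Delta> (u j) * U k"
proof -
  have comm: "y 0 * (u j * a) = u j * (y 0 * a)" for a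
    by (metis mult.assoc u_commutes_y)
  show ?thesis
    by (simp add: \<Delta>_mult distrib_left comm mult.assoc add_ac)
qed

text \<open>
  The induction step is Pascal's rule. Passing \<open>euler\<close> through the recursion for \<open>U\<close> leaves one extra
  summand \<open>y\<^sub>0 U\<^sub>n t\<close>; it supplies the term of \<open>u 1\<close> that \<open>y\<^sub>0 \<Delta>(u 0) = 0\<close> does not.
\<close>

lemma euler_U: "euler (U n) = (\<Sum>j\<le>n. of_nat (n choose j) * (u j * U (n - j))) * t"
proof (induction n)
  case (Suc n)
  let ?S = "\<Sum>j\<le>n. of_nat (n choose j) * (u j * U (n - j))"
  have comm: "y 0 * (of_nat k * a) = of_nat k * (y 0 * a)" for k a
    by (metis mult.assoc mult_of_nat_commute)
  have "y 0 * ?S * t + y 0 * \<Delta> ?S =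
      (\<Sum>j\<le>n. of_nat (n choose j) * (y 0 * (u j * U (n - j)) * t + y 0 * \<Delta> (u j * U (n - j))))"
    by (simp add: \<Delta>_sum \<Delta>_of_nat_mult sum_distrib_left sum_distrib_right comm sum.distrib
        distrib_left mult.assoc)
  also have "\<dots> = (\<Sum>j\<le>n. of_nat (n choose j) * (u j * U (Suc n - j)))
      + (\<Sum>j\<le>n. of_nat (n choose j) * (y 0 * \<Delta> (u j) * U (n - j)))"
    unfolding step_product by (simp add: distrib_left sum.distrib Suc_diff_le)
  finally have S: "y 0 * ?S * t + y 0 * \<Delta> ?S + y 0 * U n =
      (\<Sum>j\<le>n. of_nat (n choose j) * (u j * U (Suc n - j)))
      + ((\<Sum>j\<le>n. of_nat (n choose j) * (y 0 * \<Delta> (u j) * U (n - j))) + y 0 * U n)"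
    by (simp add: add.assoc)
  have "(\<Sum>j\<le>n. of_nat (n choose j) * (y 0 * \<Delta> (u j) * U (n - j))) + y 0 * U n =
      (\<Sum>j\<le>n. of_nat (n choose j) * (u (Suc j) * U (n - j)))"
    by (subst (1 2) sum.atMost_shift) (simp add: u_Suc add_ac)
  with S have S': "y 0 * ?S * t + y 0 * \<Delta> ?S + y 0 * U n =
      (\<Sum>j\<le>n. of_nat (n choose j) * (u j * U (Suc n - j)))
      + (\<Sum>j\<le>n. of_nat (n choose j) * (u (Suc j) * U (n - j)))"
    by simp
  also have "(\<Sum>j\<le>n. of_nat (n choose j) * (u j * U (Suc n - j))) =
      (\<Sum>j\<le>Suc n. of_nat (n choose j) * (u j * U (Suc n - j)))"
    by (subst sum.atMost_Suc) (simp add: binomial_eq_0)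
  also have "\<dots> = (\<Sum>j\<le>n. of_nat (n choose Suc j) * (u (Suc j) * U (n - j)))"
    by (subst sum.atMost_Suc_shift) simp
  also have "\<dots> + (\<Sum>j\<le>n. of_nat (n choose j) * (u (Suc j) * U (n - j))) =
      (\<Sum>j\<le>n. of_nat (Suc n choose Suc j) * (u (Suc j) * U (n - j)))"
    by (simp add: distrib_right sum.distrib add_ac)
  also have "\<dots> = (\<Sum>j\<le>Suc n. of_nat (Suc n choose j) * (u j * U (Suc n - j)))"
    by (subst sum.atMost_Suc_shift) simp
  finally have *: "y 0 * ?S * t + y 0 * \<Delta> ?S + y 0 * U n = \<dots>" .
  have "euler (U (Suc n)) = (y 0 * ?S * t + y 0 * \<Delta> ?S + y 0 * U n) * t"
    by (simp add: euler_add euler_mult euler_\<Delta> Suc.IH \<Delta>_mult \<Delta>_t algebra_simps)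
  then show ?case unfolding * .
qed simp

section \<open>Reduction modulo \<open>p\<close>\<close>

text \<open>Because \<open>j (n choose j) = n (n - 1 choose j - 1)\<close> is divisible by \<open>n = p^m\<close>, while \<open>j < n\<close> is not.\<close>

lemma prime_dvd_prime_power_choose:
  fixes p :: nat
  assumes "prime p" "0 < j" "j < p ^ m"
  shows "p dvd (p ^ m choose j)"
proof (rule ccontr)
  assume "\<not> p dvd (p ^ m choose j)"
  then have "coprime (p ^ m) (p ^ m choose j)"
    using assms(1) by (simp add: prime_imp_coprime)
  moreover have "p ^ m dvd j * (p ^ m choose j)"
    using assms(2) by (simp add: times_binomial_minus1_eq)
  ultimately have "p ^ m dvd j" by (simp add: coprime_dvd_mult_left_iff)
  then show False using assms by (auto dest: dvd_imp_le)
qed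

lemma euler_U_prime_power:
  assumes "prime p"
  shows "[Poly_Mapping.lookup (euler (U (p ^ m))) w = Poly_Mapping.lookup (u (p ^ m) * t) w] (mod int p)"
proof -
  let ?n = "p ^ m"
  let ?f = "\<lambda>j. of_nat (?n choose j) * (u j * U (?n - j) * t)"
  have n: "?n > 0" using assms by (simp add: prime_gt_0_nat)
  have "euler (U ?n) = (\<Sum>j\<le>?n. ?f j)"
    by (simp add: euler_U sum_distrib_right mult.assoc)
  also have "\<dots> = (\<Sum>j<?n. ?f j) + u ?n * t"
    by (simp flip: lessThan_Suc_atMost)
  finally have "Poly_Mapping.lookup (euler (U ?n)) w - Poly_Mapping.lookup (u ?n * t) w =
      (\<Sum>j<?n. int (?n choose j) * Poly_Mapping.lookup (u j * U (?n - j) * t) w)"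
    by (simp add: lookup_add lookup_sum lookup_of_nat_mult)
  moreover have "int p dvd int (?n choose j) * Poly_Mapping.lookup (u j * U (?n - j) * t) w"
    if "j < ?n" for j
  proof (cases "j = 0")
    case False
    then show ?thesis using prime_dvd_prime_power_choose[OF assms _ that] by (intro dvd_mult2) simp
  qed simp
  ultimately show ?thesis
    by (simp only: cong_iff_dvd_diff) (intro dvd_sum, simp)
qed

lemma lookup_u_t:
  assumes "t_degree w \<noteq> 1" shows "Poly_Mapping.lookup (u n * t) w = 0"
proof -
  have "euler (u n * t) = u n * t" by (simp add: euler_mult)
  then show ?thesis using assms lookup_euler[of "u n * t" w] by simp
qed

lemma c_prime_power_cong_0:
  assumes "prime p" "sum_list lam \<noteq> p ^ m - 1" "\<not> p dvd sum_list lam"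
  shows "[c (p ^ m) lam = 0] (mod int p)"
proof (cases "sum_list lam < p ^ m")
  case True
  let ?k = "p ^ m - sum_list lam" and ?w = "U_mon (p ^ m) lam"
  \<comment> \<open>For \<open>n = 1\<close> the only partition with \<open>|\<lambda>| < n\<close> is empty, and \<open>p\<close> divides \<open>0\<close>.\<close>
  have "m \<noteq> 0" using True assms(3) by (metis dvd_0_right less_one power_0)
  then have "p dvd p ^ m" by simp
  then have "\<not> p dvd ?k"
    using True assms(3) by (metis dvd_diffD1 less_imp_le)
  then have coprime: "coprime (int ?k) (int p)"
    using assms(1) by (metis coprime_commute coprime_int_iff prime_imp_coprime)
  have "?k \<noteq> 1" using assms(2) True by simp
  then have "Poly_Mapping.lookup (u (p ^ m) * t) ?w = 0"
    by (intro lookup_u_t) (simp add: t_degree_U_mon)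
  then have "[int ?k * c (p ^ m) lam = int ?k * 0] (mod int p)"
    using euler_U_prime_power[OF assms(1), of m ?w] True
    by (simp add: lookup_euler t_degree_U_mon c_def)
  then show ?thesis using coprime by (simp only: cong_mult_lcancel)
qed (simp add: c_def)

theorem theorem4p8:
  fixes p :: nat
  assumes "prime p"
  shows "(\<forall>n m lam. n = p ^ m \<and> is_partition lam \<and> sum_list lam \<noteq> n - 1 \<and> \<not> p dvd sum_list lam
            \<longrightarrow> [c n lam = 0] (mod int p)) \<and>
         (\<forall>lam. is_partition lam \<and> sum_list lam \<noteq> 0 \<and> sum_list lam \<noteq> p - 1
            \<longrightarrow> [c p lam = 0] (mod int p))"
proof (intro conjI allI impI; elim conjE)
  fix lam assume *: "sum_list lam \<noteq> 0" "sum_list lam \<noteq> p - 1"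
  show "[c p lam = 0] (mod int p)"
  proof (cases "p dvd sum_list lam")
    case True
    then have "\<not> sum_list lam < p" using *(1) by (metis dvd_imp_le gr0I not_less)
    then show ?thesis by (simp add: c_def)
  next
    case False
    then show ?thesis using c_prime_power_cong_0[OF assms, of lam 1] *(2) by simp
  qed
qed (use c_prime_power_cong_0[OF assms] in blast)

end
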